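(* Let $H$ be a Hilbert space, let $\delta > 0$ and $C<\infty$, and suppose that $\mathbb{D}\subset H$ is a dictionary with $\|g\|_H\le 1$ for all $g\in\mathbb{D}$ which satisfies $$\epsilon_n(B_1(\mathbb{D}))_H \leq C n^{-\frac{1}{2}-\delta}\qquad\text{for all } n\ge 1.$$ Then there is a constant $K$ depending only upon $\delta$ and $C$ such that the following holds. Let $f\in H$, let $f_n$ be the iterates of the orthogonal greedy algorithm applied to $f$ with dictionary $\mathbb{D}$, and let $h\in\mathcal{K}_1(\mathbb{D})$ be arbitrary. Then for all $n\ge 1$ $$\|f_n - f\|_H^2 \leq \|f-h\|_H^2 + K\|h\|_{\mathcal{K}_1(\mathbb{D})}^2\, n^{-1-2\delta}.$$ In particular, there is a constant $K'$ depending only upon $\delta$ and $C$ such that if $f\in\mathcal{K}_1(\mathbb{D})$, then for all $n\geq 1$ $$\|f_n - f\|_H \leq K'\|f\|_{\mathcal{K}_1(\mathbb{D})}\, n^{-\frac{1}{2}-\delta}.$$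
   Context: Hilbert spaces are real. A dictionary is a subset $\mathbb{D}\subset H$. The (closed, symmetric) convex hull of $\mathbb{D}$ is $$B_1(\mathbb{D}) = \overline{\left\{\sum_{j=1}^n a_jh_j:~n\in\mathbb{N},~h_j\in\mathbb{D},~a_j\in\mathbb{R},~\sum_{j=1}^n|a_j|\le 1\right\}},$$ with closure in $H$. The variation norm is $\|f\|_{\mathcal{K}_1(\mathbb{D})} = \inf\{c>0: f\in cB_1(\mathbb{D})\}$ (equal to $+\infty$ if there is no such $c$), and $\mathcal{K}_1(\mathbb{D})=\{f\in H:\|f\|_{\mathcal{K}_1(\mathbb{D})}<\infty\}$. The (dyadic) metric entropy of $A\subset H$ is $\epsilon_n(A)_H=\inf\{\epsilon: A \text{ can be covered by } 2^n \text{ balls of radius } \epsilon \text{ in } H\}$. The orthogonal greedy algorithm applied to $f\in H$ with dictionary $\mathbb{D}$ generates iterates $f_k$ by $f_0=0$ and, for $k\ge1$, $$g_k\in\arg\max_{g\in\mathbb{D}}|\langle g,r_{k-1}\rangle|,\qquad f_k=P_kf,$$ where $r_{k}=f-f_{k}$ is the residual and $P_k$ is the orthogonal projection onto $\mathrm{span}(g_1,\dots,g_k)$. It is understood that the maxima are attained; $g_k$ may be any maximizer. *)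

theory Defs
  imports "HOL-Analysis.Analysis"
begin

definition dict_hull :: "'a::real_inner set \<Rightarrow> 'a set" where
  "dict_hull D = closure {(\<Sum>j<n. a j *\<^sub>R h j) | (n::nat) (a :: nat \<Rightarrow> real) (h :: nat \<Rightarrow> 'a).
     (\<forall>j<n. h j \<in> D) \<and> (\<Sum>j<n. \<bar>a j\<bar>) \<le> 1}"

text \<open>Values in \<^typ>\<open>ereal\<close>, where the infimum of the empty set is \<open>\<infinity>\<close>.\<close>

definition variation_norm :: "'a::real_inner set \<Rightarrow> 'a \<Rightarrow> ereal" where
  "variation_norm D f = Inf {ereal c | c. c > 0 \<and> f \<in> (\<lambda>x. c *\<^sub>R x) ` dict_hull D}"

definition variation_space :: "'a::real_inner set \<Rightarrow> 'a set" where
  "variation_space D = {f. variation_norm D f < \<infinity>}"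

text \<open>Centres may be repeated, so this is a covering by at most \<open>2 ^ n\<close> balls; the infimum
  does not depend on whether the balls are open or closed.\<close>

definition metric_entropy :: "nat \<Rightarrow> 'a::metric_space set \<Rightarrow> ereal" where
  "metric_entropy n A =
     Inf {ereal \<epsilon> | \<epsilon>. \<epsilon> > 0 \<and> (\<exists>x :: nat \<Rightarrow> 'a. A \<subseteq> (\<Union>i<2 ^ n. cball (x i) \<epsilon>))}"

definition is_orthogonal_projection :: "'a::real_inner set \<Rightarrow> 'a \<Rightarrow> 'a \<Rightarrow> bool" where
  "is_orthogonal_projection V f p \<longleftrightarrow> p \<in> V \<and> (\<forall>v\<in>V. orthogonal (f - p) v)"

text \<open>Maximizers need not exist or be unique, so the algorithm is a relation:
  \<open>g\<close> (used from index 1) and \<open>F\<close> are the selected elements and the iterates of some run.\<close>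

definition orthogonal_greedy_run ::
    "'a::real_inner set \<Rightarrow> 'a \<Rightarrow> (nat \<Rightarrow> 'a) \<Rightarrow> (nat \<Rightarrow> 'a) \<Rightarrow> bool" where
  "orthogonal_greedy_run D f g F \<longleftrightarrow>
     F 0 = 0 \<and>
     (\<forall>k\<ge>1. is_arg_max (\<lambda>u. \<bar>u \<bullet> (f - F (k - 1))\<bar>) (\<lambda>u. u \<in> D) (g k) \<and>
            is_orthogonal_projection (span (g ` {1..k})) f (F k))"

text \<open>The constants must not depend on the Hilbert space, but an existential quantifier inside a
  theorem about a space \<open>'a\<close> would let them vary with that type. They are therefore fixed here as
  functions of \<open>\<delta>\<close> and \<open>C\<close> only. The values are not sharp: with \<open>d\<^sub>k\<close> the distance of \<open>g\<^sub>k\<close> to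
  the span of its predecessors, the greedy recursion gives an error term
  \<open>4 * M\<^sup>2 / n * (\<Prod>k=1..n. d\<^sub>k) powr (2 / n)\<close> with \<open>M\<close> the variation norm, and comparing the
  volume of the simplex spanned by 0 and the \<open>g\<^sub>k\<close> with that of the \<open>2 ^ n\<close> covering balls bounds
  this by \<open>32 * pi * exp 1 * C\<^sup>2 * M\<^sup>2 * n powr (-1 - 2 * \<delta>)\<close>, and \<open>32 * pi * exp 1 < 1024\<close>.\<close>

definition greedy_const :: "real \<Rightarrow> real \<Rightarrow> real" where
  "greedy_const \<delta> C = 1024 * C\<^sup>2"

definition greedy_const' :: "real \<Rightarrow> real \<Rightarrow> real" where
  "greedy_const' \<delta> C = 32 * C"

end

theory Submission
  imports Defs "HOL-Probability.Distributions"
begin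

text \<open>Let \<open>r\<^sub>k\<close> be the residuals, \<open>M\<close> the variation norm of \<open>h\<close>, \<open>a\<^sub>k = (norm r\<^sub>k)\<^sup>2 - (norm (f - h))\<^sup>2\<close> the excess
  error, and \<open>d\<^sub>k\<close> the distance of the \<open>k\<close>-th selected element from the span of the earlier ones. Two facts
  about a greedy step drive the proof. Since the selected element maximizes the inner product with the
  residual over the dictionary, and hence over the convex hull, this inner product is at least
  \<open>a\<^sub>k / (2 * M)\<close>. Since only the component of the selected element orthogonal to the earlier ones matters
  for the projection, the squared error drops by the square of the inner product divided by \<open>d\<^sub>k\<^sup>2\<close>
  (\<open>residual_norm_decrease\<close>): a selected element that is close to the old span is a very efficient one.
  As long as \<open>a\<^sub>n\<close> is positive, the two facts give that \<open>4 * M\<^sup>2 / a\<^sub>n\<close> is at least the sum of the first \<open>n\<close>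
  terms \<open>1 / d\<^sub>k\<^sup>2\<close> (\<open>greedy_recursion\<close>).

  It remains to see that the \<open>d\<^sub>k\<close> are small on average. Their product is \<open>fact n\<close> times the volume of the
  simplex spanned by 0 and the selected elements. This simplex lies in the convex hull of the dictionary
  and is thus covered by \<open>2 ^ n\<close> balls of radius \<open>\<epsilon>\<close>, and comparing volumes shows that the product is at
  most \<open>(16 * \<epsilon> * sqrt n) ^ n\<close> (\<open>prod_norm_orthogonal_part_le\<close>). By the inequality between arithmetic and
  geometric means the sum of the \<open>1 / d\<^sub>k\<^sup>2\<close> is then at least \<open>n / (16 * \<epsilon> * sqrt n)\<^sup>2 = 1 / (256 * \<epsilon>\<^sup>2)\<close>,
  so that \<open>a\<^sub>n \<le> 1024 * M\<^sup>2 * \<epsilon>\<^sup>2\<close>. With \<open>\<epsilon> = C * n powr (- 1/2 - \<delta>)\<close> this is the claim, and \<open>h = f\<close> gives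
  the second bound.\<close>

section \<open>Orthogonal parts of a sequence\<close>

text \<open>The ambient space is an arbitrary real inner product space, so this is one step of the
  Gram--Schmidt process per vector: the projection onto the larger span adds the component along
  the part \<open>u\<close> of the new vector that is orthogonal to the old span.\<close>
lemma orthogonal_projection_onto_span_exists:
  fixes x :: "'a::real_inner"
  assumes "finite B"
  shows "\<exists>p. is_orthogonal_projection (span B) x p"
  using assms
proof (induction B arbitrary: x rule: finite_induct)
  case empty
  show ?case by (auto simp: is_orthogonal_projection_def orthogonal_def)
next
  case (insert b B)
  obtain p where p: "p \<in> span B" "\<And>v. v \<in> span B \<Longrightarrow> (x - p) \<bullet> v = 0"
    using insert.IH[of x] by (auto simp: is_orthogonal_projection_def orthogonal_def)
  obtain q where q: "q \<in> span B" "\<And>v. v \<in> span B \<Longrightarrow> (b - q) \<bullet> v = 0"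
    using insert.IH[of b] by (auto simp: is_orthogonal_projection_def orthogonal_def)
  define u where "u = b - q"
  define t where "t = ((x - p) \<bullet> u) / (u \<bullet> u)"
  have tu: "t * (u \<bullet> u) = (x - p) \<bullet> u" by (simp add: t_def)
  have sub: "span B \<subseteq> span (insert b B)" by (rule span_mono) auto
  have b: "b \<in> span (insert b B)" by (simp add: span_base)
  have "p + t *\<^sub>R u \<in> span (insert b B)"
    unfolding u_def using p(1) q(1) sub b by (intro span_add span_scale span_diff) auto
  moreover have "(x - (p + t *\<^sub>R u)) \<bullet> v = 0" if "v \<in> span (insert b B)" for v
  proof -
    obtain k where k: "v - k *\<^sub>R b \<in> span B" using \<open>v \<in> span (insert b B)\<close>
      by (auto simp: span_insert)
    define w where "w = v - k *\<^sub>R b + k *\<^sub>R q"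
    have w: "w \<in> span B" unfolding w_def using k q(1) by (intro span_add span_scale)
    have v: "v = w + k *\<^sub>R u" by (simp add: w_def u_def algebra_simps)
    have "(x - p) \<bullet> w = 0" "u \<bullet> w = 0" using p(2)[OF w] q(2)[OF w] by (auto simp: u_def)
    then show ?thesis using tu
      by (simp add: v inner_diff_left inner_add_right inner_add_left algebra_simps)
  qed
  ultimately show ?case by (auto simp: is_orthogonal_projection_def orthogonal_def)
qed

text \<open>The \<open>k\<close>-th vector of the Gram--Schmidt process before normalization. Its norm is the distance
  from \<open>g k\<close> to the span of \<open>g 0, \<dots>, g (k - 1)\<close>, and the product of these norms is the volume of the
  parallelepiped spanned by the vectors.\<close>
definition orthogonal_part :: "(nat \<Rightarrow> 'a::real_inner) \<Rightarrow> nat \<Rightarrow> 'a" where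
  "orthogonal_part g k =
     g k - (SOME p. is_orthogonal_projection (span (g ` {..<k})) (g k) p)"

lemma
  shows diff_orthogonal_part_in_span: "g k - orthogonal_part g k \<in> span (g ` {..<k})"
    and orthogonal_part_inner_span: "v \<in> span (g ` {..<k}) \<Longrightarrow> orthogonal_part g k \<bullet> v = 0"
  using someI_ex[OF orthogonal_projection_onto_span_exists[of "g ` {..<k}" "g k"]]
  by (auto simp: orthogonal_part_def is_orthogonal_projection_def orthogonal_def)

section \<open>Gaussian integrals over linear combinations\<close>
lemma nn_integral_gaussian:
  fixes l d c :: real
  assumes "l > 0" "d > 0"
  shows "(\<integral>\<^sup>+y. ennreal (exp (- l * (d * (y - c))\<^sup>2)) \<partial>lborel) = ennreal (sqrt (pi / l) / d)"
proof -
  define s where "s = 1 / (d * sqrt (2 * l))"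
  have s: "s > 0" using assms by (simp add: s_def)
  have s2: "2 * s\<^sup>2 = 1 / (l * d\<^sup>2)" using assms by (simp add: s_def power_divide power_mult_distrib)
  have sq: "sqrt (2 * pi * s\<^sup>2) = sqrt (pi / l) / d"
  proof -
    have "2 * pi * s\<^sup>2 = pi * (2 * s\<^sup>2)" by simp
    also have "\<dots> = (pi / l) / d\<^sup>2" by (simp add: s2)
    finally show ?thesis using assms by (simp add: real_sqrt_divide real_sqrt_mult)
  qed
  have pos: "sqrt (pi / l) / d > 0" using assms by simp
  have eq: "exp (- l * (d * (y - c))\<^sup>2) = (sqrt (pi / l) / d) * normal_density c s y" for y
    using assms unfolding normal_density_def s2 sq
    by (simp add: power_mult_distrib mult_ac)
  interpret prob_space "density lborel (normal_density c s)"
    by (rule prob_space_normal_density[OF s])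
  have "(\<integral>\<^sup>+y. ennreal (normal_density c s y) \<partial>lborel) = 1"
    using emeasure_space_1 by (simp add: emeasure_density)
  then show ?thesis unfolding eq ennreal_mult[OF less_imp_le[OF pos] normal_density_nonneg]
    by (subst nn_integral_cmult) auto
qed

text \<open>The ambient space need not be second countable, so vector addition need not be measurable for the
  product of the Borel algebras; expanding the squared norm leaves a polynomial in the real coordinates.\<close>
lemma measurable_gaussian_of_linear_combination:
  fixes g :: "nat \<Rightarrow> 'a::real_inner"
  shows "(\<lambda>t. ennreal (exp (- l * (norm ((\<Sum>k<n. t k *\<^sub>R g k) - x))\<^sup>2)))
    \<in> borel_measurable (Pi\<^sub>M {..<n} (\<lambda>_. lborel))"
proof -
  have *: "(norm ((\<Sum>k<n. t k *\<^sub>R g k) - x))\<^sup>2 =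
      (\<Sum>j<n. \<Sum>k<n. t j * (t k * (g k \<bullet> g j))) - 2 * (\<Sum>k<n. t k * (g k \<bullet> x)) + x \<bullet> x"
    (is "?l t = ?r t") for t
  proof -
    have "?l t = (\<Sum>k<n. t k *\<^sub>R g k) \<bullet> (\<Sum>k<n. t k *\<^sub>R g k)
        - 2 * ((\<Sum>k<n. t k *\<^sub>R g k) \<bullet> x) + x \<bullet> x"
      by (simp add: power2_norm_eq_inner inner_diff_left inner_diff_right inner_commute)
    then show ?thesis
      by (simp only: inner_sum_right) (simp add: inner_sum_left sum_distrib_left)
  qed
  have [measurable]: "(\<lambda>t. t k) \<in> borel_measurable (Pi\<^sub>M {..<n} (\<lambda>_. lborel :: real measure))"
    if "k < n" for k
    using measurable_component_singleton[of k "{..<n}" "\<lambda>_. lborel :: real measure"] that by simp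
  show ?thesis unfolding *
    by (intro measurable_compose[OF _ measurable_ennreal] borel_measurable_exp borel_measurable_times
        borel_measurable_const borel_measurable_add borel_measurable_diff borel_measurable_sum) auto
qed

text \<open>The integrals are taken in the coordinates \<open>t\<close>, so that no volume on a subspace of varying
  dimension is needed. The last coordinate \<open>y\<close> alone moves the combination in the direction of \<open>u\<close>, the
  orthogonal part of the last vector. By Pythagoras the Gaussian splits into a one-dimensional Gaussian
  in \<open>y\<close> of width proportional to \<open>1 / norm u\<close> and a Gaussian of the combination of the first \<open>n\<close> vectors,
  whose centre depends on \<open>y\<close>. The induction hypothesis is uniform in the centre, so the bounds multiply.\<close>
lemma gaussian_integral_le:
  fixes g :: "nat \<Rightarrow> 'a::real_inner"
  assumes "l > 0" and "\<And>k. k < n \<Longrightarrow> orthogonal_part g k \<noteq> 0"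
  shows "(\<integral>\<^sup>+t. ennreal (exp (- l * (norm ((\<Sum>k<n. t k *\<^sub>R g k) - x))\<^sup>2)) \<partial>Pi\<^sub>M {..<n} (\<lambda>_. lborel))
    \<le> ennreal (\<Prod>k<n. sqrt (pi / l) / norm (orthogonal_part g k))"
  using assms(2)
proof (induction n arbitrary: x)
  case 0
  have "exp (- l * (norm x)\<^sup>2) \<le> 1" using assms(1) by simp
  then show ?case by (simp add: PiM_empty)
next
  case (Suc n)
  interpret product_sigma_finite "\<lambda>_. lborel" by standard
  define u where "u = orthogonal_part g n"
  define p where "p = g n - u"
  \<comment> \<open>The coefficient of the centre along \<open>u\<close>; \<open>x'\<close> is the rest, orthogonal to \<open>u\<close>.\<close>
  define c where "c = (x \<bullet> u) / (u \<bullet> u)"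
  define x' where "x' = x - c *\<^sub>R u"
  let ?V = "span (g ` {..<n})"
  let ?P = "\<Prod>k<n. sqrt (pi / l) / norm (orthogonal_part g k)"
  have u0: "u \<noteq> 0" using Suc.prems[of n] by (simp add: u_def)
  have p: "p \<in> ?V" using diff_orthogonal_part_in_span by (simp add: p_def u_def)
  have ux': "u \<bullet> x' = 0" using u0 by (simp add: x'_def c_def inner_diff_right inner_commute)
  have P0: "?P \<ge> 0" using assms(1) by (intro prod_nonneg) auto
  have split: "exp (- l * (norm ((\<Sum>k<Suc n. (t(n := y)) k *\<^sub>R g k) - x))\<^sup>2) =
      exp (- l * (norm u * (y - c))\<^sup>2) * exp (- l * (norm ((\<Sum>k<n. t k *\<^sub>R g k) - (x' - y *\<^sub>R p)))\<^sup>2)"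
    for t :: "nat \<Rightarrow> real" and y
  proof -
    let ?s = "\<Sum>k<n. t k *\<^sub>R g k"
    let ?w = "?s - (x' - y *\<^sub>R p)"
    have "?s \<in> ?V" by (intro span_sum span_scale span_base) auto
    then have "?s + y *\<^sub>R p \<in> ?V" using p by (intro span_add span_scale)
    then have "u \<bullet> (?s + y *\<^sub>R p) = 0" unfolding u_def by (rule orthogonal_part_inner_span)
    then have "u \<bullet> ?w = 0"
      using ux' by (simp add: inner_diff_right inner_add_right)
    then have "((y - c) *\<^sub>R u) \<bullet> ?w = 0" by simp
    then have pyth: "(norm ((y - c) *\<^sub>R u + ?w))\<^sup>2 = (norm ((y - c) *\<^sub>R u))\<^sup>2 + (norm ?w)\<^sup>2"
      by (intro norm_add_Pythagorean) (simp only: orthogonal_def)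
    have "(\<Sum>k<Suc n. (t(n := y)) k *\<^sub>R g k) - x = (y - c) *\<^sub>R u + ?w"
      by (simp add: x'_def p_def algebra_simps)
    then have "(norm ((\<Sum>k<Suc n. (t(n := y)) k *\<^sub>R g k) - x))\<^sup>2
        = (norm u * (y - c))\<^sup>2 + (norm ?w)\<^sup>2"
      using pyth by (simp only: norm_scaleR power_mult_distrib power2_abs mult.commute)
    then show ?thesis by (simp only: distrib_left exp_add)
  qed
  have "(\<integral>\<^sup>+t. ennreal (exp (- l * (norm ((\<Sum>k<Suc n. t k *\<^sub>R g k) - x))\<^sup>2)) \<partial>Pi\<^sub>M {..<Suc n} (\<lambda>_. lborel))
     = (\<integral>\<^sup>+y. (\<integral>\<^sup>+t. ennreal (exp (- l * (norm ((\<Sum>k<Suc n. (t(n := y)) k *\<^sub>R g k) - x))\<^sup>2))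
          \<partial>Pi\<^sub>M {..<n} (\<lambda>_. lborel)) \<partial>lborel)"
    unfolding lessThan_Suc[of n]
  proof (rule product_nn_integral_insert_rev)
    show "(\<lambda>t. ennreal (exp (- l * (norm ((\<Sum>k\<in>insert n {..<n}. t k *\<^sub>R g k) - x))\<^sup>2)))
        \<in> borel_measurable (Pi\<^sub>M (insert n {..<n}) (\<lambda>_. lborel))"
      using measurable_gaussian_of_linear_combination[where n = "Suc n"]
      unfolding lessThan_Suc[of n] .
  qed auto
  also have "\<dots> = (\<integral>\<^sup>+y. ennreal (exp (- l * (norm u * (y - c))\<^sup>2)) *
      (\<integral>\<^sup>+t. ennreal (exp (- l * (norm ((\<Sum>k<n. t k *\<^sub>R g k) - (x' - y *\<^sub>R p)))\<^sup>2))
        \<partial>Pi\<^sub>M {..<n} (\<lambda>_. lborel)) \<partial>lborel)"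
    unfolding split ennreal_mult[OF exp_ge_zero exp_ge_zero]
    by (intro nn_integral_cong nn_integral_cmult measurable_gaussian_of_linear_combination)
  also have "\<dots> \<le> (\<integral>\<^sup>+y. ennreal (exp (- l * (norm u * (y - c))\<^sup>2)) * ennreal ?P \<partial>lborel)"
    using Suc by (intro nn_integral_mono mult_left_mono) auto
  also have "\<dots> = ennreal (sqrt (pi / l) / norm u) * ennreal ?P"
    using nn_integral_gaussian[OF assms(1), of "norm u" c] u0 by (simp add: nn_integral_multc)
  also have "\<dots> = ennreal (\<Prod>k<Suc n. sqrt (pi / l) / norm (orthogonal_part g k))"
    using P0 assms(1) by (simp add: u_def ennreal_mult[symmetric] mult.commute)
  finally show ?case .
qed

section \<open>The volume of a simplex covered by balls\<close>

text \<open>On a ball of radius \<open>\<epsilon>\<close> the function \<open>exp (l * (\<epsilon>\<^sup>2 - (norm (v - x i))\<^sup>2))\<close> is at least 1. The sum of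
  these functions over all centres therefore dominates the indicator of the covered simplex, whose
  measure in coordinates is \<open>1 / fact n\<close>. Replacing balls by Gaussians makes the integral factor into
  one-dimensional ones and gives, for the best \<open>l\<close>, the bound that Stirling's formula extracts from the
  exact volume of the ball, up to lower-order factors. Since \<open>fact n \<le> n ^ n\<close>, the product is at most
  \<open>(2 * sqrt (2 * pi * exp 1) * \<epsilon> * sqrt n) ^ n\<close>.\<close>
lemma prod_norm_orthogonal_part_le:
  fixes g :: "nat \<Rightarrow> 'a::real_inner" and x :: "nat \<Rightarrow> 'a"
  assumes n: "n \<ge> 1" and \<epsilon>: "\<epsilon> > 0"
    and cover: "\<And>t. (\<forall>k<n. 0 \<le> t k) \<Longrightarrow> (\<Sum>k<n. t k) \<le> 1 \<Longrightarrow>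
      (\<Sum>k<n. t k *\<^sub>R g k) \<in> (\<Union>i<2 ^ n. cball (x i) \<epsilon>)"
  shows "(\<Prod>k<n. norm (orthogonal_part g k)) \<le> (16 * \<epsilon> * sqrt (real n)) ^ n"
proof (cases "\<forall>k<n. orthogonal_part g k \<noteq> 0")
  case False
  then have zero: "(\<Prod>k<n. norm (orthogonal_part g k)) = 0" by (subst prod_zero_iff) auto
  show ?thesis unfolding zero using \<epsilon> by simp
next
  case True
  \<comment> \<open>This value minimizes \<open>exp (l * \<epsilon>\<^sup>2) * l powr (- n / 2)\<close>.\<close>
  define l where "l = real n / (2 * \<epsilon>\<^sup>2)"
  have l: "l > 0" using n \<epsilon> by (simp add: l_def)
  have l\<epsilon>: "l * \<epsilon>\<^sup>2 = real n / 2" using \<epsilon> by (simp add: l_def)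
  let ?L = "Pi\<^sub>M {..<n} (\<lambda>_. lborel) :: (nat \<Rightarrow> real) measure"
  let ?d = "\<Prod>k<n. norm (orthogonal_part g k)"
  let ?G = "\<lambda>i t. exp (- l * (norm ((\<Sum>k<n. t k *\<^sub>R g k) - x i))\<^sup>2)"
  define T where "T = {t. (\<forall>k\<in>{..<n}. 0 \<le> t k) \<and> sum t {..<n} \<le> 1} \<inter> space ?L"
  have d: "?d > 0" using True by (intro prod_pos) auto
  have T: "emeasure ?L T = ennreal (1 / fact n)"
    using emeasure_std_simplex_aux[of "{..<n}" 1]
    by (simp add: T_def divide_ennreal[symmetric] ennreal_fact)
  \<comment> \<open>A set outside the sigma-algebra would have measure 0.\<close>
  have "T \<in> sets ?L"
  proof (rule ccontr)
    assume "T \<notin> sets ?L"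
    then have "ennreal (1 / fact n) = 0" using T emeasure_notin_sets by metis
    then have "1 / fact n \<le> (0::real)" by (simp only: ennreal_eq_0_iff)
    then show False using fact_gt_zero[of n, where 'a = real] by (simp add: divide_le_0_iff)
  qed
  have point: "indicator T t \<le> (\<Sum>i<2 ^ n. ennreal (exp (real n / 2)) * ennreal (?G i t))" for t
  proof (cases "t \<in> T")
    case True
    then have "(\<Sum>k<n. t k *\<^sub>R g k) \<in> (\<Union>i<2 ^ n. cball (x i) \<epsilon>)"
      by (intro cover) (auto simp: T_def)
    then obtain i where i: "i < 2 ^ n" "norm ((\<Sum>k<n. t k *\<^sub>R g k) - x i) \<le> \<epsilon>"
      by (auto simp: dist_norm norm_minus_commute)
    have "l * (norm ((\<Sum>k<n. t k *\<^sub>R g k) - x i))\<^sup>2 \<le> l * \<epsilon>\<^sup>2"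
      using i(2) l by (intro mult_left_mono power_mono) auto
    then have "1 \<le> exp (real n / 2) * ?G i t"
      unfolding exp_add[symmetric] l\<epsilon> by simp
    then have "ennreal 1 \<le> ennreal (exp (real n / 2) * ?G i t)" by (rule ennreal_leI)
    also have "\<dots> = ennreal (exp (real n / 2)) * ennreal (?G i t)" by (simp add: ennreal_mult)
    also have "\<dots> \<le> (\<Sum>i<2 ^ n. ennreal (exp (real n / 2)) * ennreal (?G i t))"
      using i(1) by (intro member_le_sum) auto
    finally show ?thesis using True by simp
  qed simp
  let ?b = "2 ^ n * exp (real n / 2) * (sqrt (pi / l) ^ n / ?d)"
  have "ennreal (1 / fact n) = (\<integral>\<^sup>+t. indicator T t \<partial>?L)"
    using T \<open>T \<in> sets ?L\<close> by simp
  also have "\<dots> \<le> (\<integral>\<^sup>+t. (\<Sum>i<2 ^ n. ennreal (exp (real n / 2)) * ennreal (?G i t)) \<partial>?L)"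
    by (intro nn_integral_mono point)
  also have "\<dots> = (\<Sum>i<2 ^ n. ennreal (exp (real n / 2)) * (\<integral>\<^sup>+t. ennreal (?G i t) \<partial>?L))"
    by (subst nn_integral_sum)
      (intro borel_measurable_times_ennreal borel_measurable_const sum.cong refl nn_integral_cmult
        measurable_gaussian_of_linear_combination)+
  also have "\<dots> \<le> (\<Sum>i<(2::nat) ^ n. ennreal (exp (real n / 2)) *
      ennreal (\<Prod>k<n. sqrt (pi / l) / norm (orthogonal_part g k)))"
    using True by (intro sum_mono mult_left_mono gaussian_integral_le l) auto
  also have "\<dots> = (\<Sum>i<(2::nat) ^ n. ennreal (exp (real n / 2) * (sqrt (pi / l) ^ n / ?d)))"
    using l d by (subst ennreal_mult[symmetric]) (auto simp: prod_dividef intro: prod_nonneg)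
  also have "\<dots> = ennreal (\<Sum>i<(2::nat) ^ n. exp (real n / 2) * (sqrt (pi / l) ^ n / ?d))"
    using l d by (intro sum_ennreal mult_nonneg_nonneg divide_nonneg_nonneg) auto
  also have "\<dots> = ennreal ?b"
    by (simp add: mult.assoc)
  finally have "ennreal (1 / fact n) \<le> ennreal ?b" .
  moreover have "?b \<ge> 0" using l d by simp
  ultimately have "1 / fact n \<le> ?b" by (simp add: ennreal_le_iff)
  then have "?d \<le> fact n * (2 ^ n * exp (real n / 2) * sqrt (pi / l) ^ n)"
    using d by (simp add: field_simps)
  also have "\<dots> \<le> real n ^ n * (2 ^ n * exp (real n / 2) * sqrt (pi / l) ^ n)"
    using l fact_le_power[of n, where 'a = real] by (intro mult_right_mono) auto
  also have "\<dots> = (real n * (2 * exp (1 / 2) * sqrt (pi / l))) ^ n"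
    using exp_of_nat_mult[of n "1 / 2 :: real"] by (simp add: power_mult_distrib)
  also have "\<dots> \<le> (16 * \<epsilon> * sqrt (real n)) ^ n"
  proof (rule power_mono[OF power2_le_imp_le])
    have e: "(exp (1 / 2))\<^sup>2 = exp (1::real)" using exp_double[of "1 / 2 :: real"] by simp
    have "pi * exp 1 \<le> 4 * (3::real)"
      using pi_less_4 exp_le by (intro mult_mono) auto
    then have "8 * (pi * exp 1) * (\<epsilon>\<^sup>2 * real n) \<le> 256 * (\<epsilon>\<^sup>2 * real n)"
      by (intro mult_right_mono) auto
    moreover have "(real n * (2 * exp (1 / 2) * sqrt (pi / l)))\<^sup>2
        = 8 * (pi * exp 1) * (\<epsilon>\<^sup>2 * real n)"
      using l n by (simp add: power_mult_distrib e) (simp add: l_def power2_eq_square)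
    ultimately show "(real n * (2 * exp (1 / 2) * sqrt (pi / l)))\<^sup>2 \<le> (16 * \<epsilon> * sqrt (real n))\<^sup>2"
      by (simp add: power_mult_distrib)
  qed (use \<epsilon> l in auto)
  finally show ?thesis .
qed

section \<open>One step of the greedy algorithm\<close>

text \<open>The new residual is the shortest vector of the form \<open>f - w\<close> with \<open>w\<close> in the enlarged span. It is
  compared with \<open>w = p + t *\<^sub>R u\<close>, where \<open>u\<close> is the orthogonal part of \<open>g k\<close> and \<open>t\<close> is optimal. The old
  residual is orthogonal to the old span, hence has the same inner product with \<open>u\<close> as with \<open>g k\<close>; this
  is what puts the possibly small \<open>norm u\<close> instead of \<open>norm (g k)\<close> in the denominator.\<close>
lemma residual_norm_decrease:
  fixes f :: "'a::real_inner"
  assumes p: "is_orthogonal_projection (span (g ` {..<k})) f p"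
    and q: "is_orthogonal_projection (span (g ` {..<Suc k})) f q"
  shows "(norm (f - q))\<^sup>2 \<le> (norm (f - p))\<^sup>2 - (g k \<bullet> (f - p))\<^sup>2 / (norm (orthogonal_part g k))\<^sup>2"
    and "orthogonal_part g k = 0 \<Longrightarrow> g k \<bullet> (f - p) = 0"
proof -
  define u where "u = orthogonal_part g k"
  define t where "t = (g k \<bullet> (f - p)) / (u \<bullet> u)"
  let ?W = "span (g ` {..<Suc k})"
  have pV: "p \<in> span (g ` {..<k})" and orth: "\<And>v. v \<in> span (g ` {..<k}) \<Longrightarrow> v \<bullet> (f - p) = 0"
    using p by (auto simp: is_orthogonal_projection_def orthogonal_def inner_commute)
  have gu: "g k - u \<in> span (g ` {..<k})" unfolding u_def by (rule diff_orthogonal_part_in_span)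
  have sub: "span (g ` {..<k}) \<subseteq> ?W" by (intro span_mono image_mono) auto
  have ur: "u \<bullet> (f - p) = g k \<bullet> (f - p)" using orth[OF gu] by (simp add: inner_diff_left)
  then show "g k \<bullet> (f - p) = 0" if "orthogonal_part g k = 0" using that by (simp add: u_def)
  have "u = g k - (g k - u)" by simp
  also have "\<dots> \<in> ?W"
  proof (rule span_diff)
    show "g k \<in> ?W" by (intro span_base) auto
    show "g k - u \<in> ?W" using gu sub by auto
  qed
  finally have "p + t *\<^sub>R u \<in> ?W" using pV sub by (intro span_add span_scale) auto
  moreover have "q \<in> ?W" using q by (simp add: is_orthogonal_projection_def)
  ultimately have "q - (p + t *\<^sub>R u) \<in> ?W" by (intro span_diff)
  then have "orthogonal (f - q) (q - (p + t *\<^sub>R u))"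
    using q by (simp add: is_orthogonal_projection_def)
  note pyth = norm_add_Pythagorean[OF this]
  have "(norm (f - (p + t *\<^sub>R u)))\<^sup>2 = (norm (f - q))\<^sup>2 + (norm (q - (p + t *\<^sub>R u)))\<^sup>2"
    unfolding pyth[symmetric] by (simp only: diff_add_cancel add_diff_eq)
  then have "(norm (f - q))\<^sup>2 \<le> (norm (f - (p + t *\<^sub>R u)))\<^sup>2" by simp
  also have "\<dots> = (norm (f - p))\<^sup>2 - 2 * t * (u \<bullet> (f - p)) + t * (t * (u \<bullet> u))"
    by (simp add: power2_norm_eq_inner inner_diff_left inner_diff_right inner_add_left
        inner_add_right inner_commute algebra_simps)
  also have "\<dots> = (norm (f - p))\<^sup>2 - (g k \<bullet> (f - p))\<^sup>2 / (norm u)\<^sup>2"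
    by (cases "u = 0") (auto simp: ur t_def power2_norm_eq_inner[of u]
        power2_eq_square[of "g k \<bullet> (f - p)"])
  finally show "(norm (f - q))\<^sup>2 \<le> (norm (f - p))\<^sup>2 - (g k \<bullet> (f - p))\<^sup>2 / (norm (orthogonal_part g k))\<^sup>2"
    by (simp add: u_def)
qed

lemma abs_inner_le_on_dict_hull:
  assumes s: "\<And>u. u \<in> D \<Longrightarrow> \<bar>u \<bullet> r\<bar> \<le> s" and "s \<ge> 0" and v: "v \<in> dict_hull D"
  shows "\<bar>v \<bullet> r\<bar> \<le> s"
proof -
  have "closed {v. \<bar>v \<bullet> r\<bar> \<le> s}"
    by (intro closed_Collect_le continuous_intros)
  moreover have "{(\<Sum>j<n. a j *\<^sub>R h j) | (n::nat) (a :: nat \<Rightarrow> real) (h :: nat \<Rightarrow> 'a).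
     (\<forall>j<n. h j \<in> D) \<and> (\<Sum>j<n. \<bar>a j\<bar>) \<le> 1} \<subseteq> {v. \<bar>v \<bullet> r\<bar> \<le> s}"
  proof clarify
    fix n :: nat and a :: "nat \<Rightarrow> real" and h :: "nat \<Rightarrow> 'a"
    assume h: "\<forall>j<n. h j \<in> D" and a: "(\<Sum>j<n. \<bar>a j\<bar>) \<le> 1"
    have "\<bar>(\<Sum>j<n. a j *\<^sub>R h j) \<bullet> r\<bar> = \<bar>\<Sum>j<n. a j * (h j \<bullet> r)\<bar>" by (simp add: inner_sum_left)
    also have "\<dots> \<le> (\<Sum>j<n. \<bar>a j\<bar> * \<bar>h j \<bullet> r\<bar>)" by (rule sum_abs[THEN order_trans]) (simp add: abs_mult)
    also have "\<dots> \<le> (\<Sum>j<n. \<bar>a j\<bar> * s)" using h s by (intro sum_mono mult_left_mono) auto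
    also have "\<dots> \<le> 1 * s"
      unfolding sum_distrib_right[symmetric] using a \<open>s \<ge> 0\<close> by (intro mult_right_mono)
    finally show "\<bar>(\<Sum>j<n. a j *\<^sub>R h j) \<bullet> r\<bar> \<le> s" by simp
  qed
  ultimately have "dict_hull D \<subseteq> {v. \<bar>v \<bullet> r\<bar> \<le> s}"
    unfolding dict_hull_def by (rule closure_minimal[rotated])
  then show ?thesis using v by auto
qed

lemma simplex_combination_in_dict_hull:
  fixes g :: "nat \<Rightarrow> 'a::real_inner"
  assumes "\<forall>k<n. g k \<in> D" "\<forall>k<n. 0 \<le> t k" "(\<Sum>k<n. t k) \<le> (1::real)"
  shows "(\<Sum>k<n. t k *\<^sub>R g k) \<in> dict_hull D"
proof -
  have "(\<Sum>k<n. \<bar>t k\<bar>) \<le> 1" using assms(2,3) by simp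
  then have "(\<Sum>k<n. t k *\<^sub>R g k) \<in> {(\<Sum>j<n. a j *\<^sub>R h j) | (n::nat) (a :: nat \<Rightarrow> real) (h :: nat \<Rightarrow> 'a).
     (\<forall>j<n. h j \<in> D) \<and> (\<Sum>j<n. \<bar>a j\<bar>) \<le> 1}"
    using assms(1) by (intro CollectI exI[of _ n] exI[of _ t] exI[of _ g]) auto
  then show ?thesis unfolding dict_hull_def by (rule closure_subset[THEN subsetD])
qed

lemma variation_norm_nonneg: "variation_norm D h \<ge> 0"
  unfolding variation_norm_def by (rule Inf_greatest) auto

lemma real_variation_norm_nonneg: "real_of_ereal (variation_norm D h) \<ge> 0"
  by (intro real_of_ereal_pos variation_norm_nonneg)

text \<open>Duality between the variation norm and the quantity that the greedy step maximizes.\<close>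
lemma abs_inner_le_variation_norm:
  assumes s: "\<And>u. u \<in> D \<Longrightarrow> \<bar>u \<bullet> r\<bar> \<le> s" and "s \<ge> 0" and h: "h \<in> variation_space D"
  shows "\<bar>h \<bullet> r\<bar> \<le> real_of_ereal (variation_norm D h) * s"
proof -
  let ?M = "real_of_ereal (variation_norm D h)"
  have M: "variation_norm D h = ereal ?M"
    using h variation_norm_nonneg[of D h] by (cases "variation_norm D h") (auto simp: variation_space_def)
  have "\<bar>h \<bullet> r\<bar> \<le> (?M + e) * s" if "e > 0" for e
  proof -
    have "variation_norm D h < ereal (?M + e)" using that by (subst M) simp
    then obtain c where c: "c > 0" "c < ?M + e" "h \<in> (\<lambda>x. c *\<^sub>R x) ` dict_hull D"
      unfolding variation_norm_def Inf_less_iff by auto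
    then obtain v where v: "v \<in> dict_hull D" "h = c *\<^sub>R v" by auto
    have "\<bar>h \<bullet> r\<bar> = c * \<bar>v \<bullet> r\<bar>" using c by (simp add: v abs_mult)
    also have "\<dots> \<le> c * s" using c abs_inner_le_on_dict_hull[OF s \<open>s \<ge> 0\<close> v(1)] by simp
    also have "\<dots> \<le> (?M + e) * s" using c \<open>s \<ge> 0\<close> by (intro mult_right_mono) auto
    finally show ?thesis .
  qed
  then have "\<forall>\<^sub>F e in at_right 0. \<bar>h \<bullet> r\<bar> \<le> (?M + e) * s"
    by (auto simp: eventually_at_right_less eventually_at_filter)
  moreover have "((\<lambda>e. (?M + e) * s) \<longlongrightarrow> (?M + 0) * s) (at_right 0)" by (intro tendsto_intros)
  ultimately show ?thesis
    using tendsto_lowerbound[of "\<lambda>e. (?M + e) * s" "(?M + 0) * s" "at_right 0"] by simp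
qed

section \<open>The greedy recursion\<close>

text \<open>While \<open>a\<close> is positive, \<open>a_le\<close> and \<open>dec\<close> combine to
  \<open>a (Suc k) \<le> a k * (1 - a k / (4 * M\<^sup>2 * (d k)\<^sup>2))\<close>. Taking reciprocals and using
  \<open>1 / (1 - x) \<ge> 1 + x\<close>, the quantity \<open>4 * M\<^sup>2 / a k\<close> grows by at least \<open>1 / (d k)\<^sup>2\<close> in each step.\<close>
lemma greedy_recursion:
  fixes a s d :: "nat \<Rightarrow> real" and M :: real
  assumes M: "M \<ge> 0"
    and a_le: "\<And>k. a k \<le> 2 * M * s k"
    and dec: "\<And>k. a (Suc k) \<le> a k - (s k)\<^sup>2 / (d k)\<^sup>2"
    and s: "\<And>k. s k \<ge> 0" and d: "\<And>k. d k \<ge> 0" "\<And>k. d k = 0 \<Longrightarrow> s k = 0"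
    and "a n > 0"
  shows "(\<forall>k<n. d k > 0) \<and> (\<Sum>k<n. 1 / (d k)\<^sup>2) \<le> 4 * M\<^sup>2 / a n"
  using \<open>a n > 0\<close>
proof (induction n)
  case 0
  then show ?case by simp
next
  case (Suc n)
  define y where "y = 1 / (4 * M\<^sup>2 * (d n)\<^sup>2)"
  have "a (Suc n) \<le> a n" using dec[of n] by (smt (verit) divide_nonneg_nonneg zero_le_power2)
  then have an: "a n > 0" using Suc.prems by simp
  with a_le[of n] have Ms: "2 * M * s n > 0" by simp
  then have Mp: "M > 0" using M by (cases "M = 0") auto
  have sp: "s n > 0" using Ms s[of n] by (cases "s n = 0") auto
  then have dp: "d n > 0" using d[of n] by fastforce
  have "(a n)\<^sup>2 \<le> (2 * M * s n)\<^sup>2" using a_le[of n] an by (intro power_mono) auto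
  then have "(a n)\<^sup>2 * y \<le> (2 * M * s n)\<^sup>2 * y" by (intro mult_right_mono) (auto simp: y_def)
  also have "\<dots> = (s n)\<^sup>2 / (d n)\<^sup>2" using Mp by (simp add: y_def power_mult_distrib)
  finally have "a (Suc n) \<le> a n * (1 - a n * y)"
    using dec[of n] by (simp add: algebra_simps power2_eq_square)
  then have "(1 / a n + y) * a (Suc n) \<le> (1 / a n + y) * (a n * (1 - a n * y))"
    using an by (intro mult_left_mono) (auto simp: y_def)
  also have "\<dots> = 1 - (a n * y)\<^sup>2" using an by (simp add: field_simps power2_eq_square)
  also have "\<dots> \<le> 1" by simp
  finally have "1 / a n + y \<le> 1 / a (Suc n)" using Suc.prems by (simp add: field_simps)
  then have "4 * M\<^sup>2 * (1 / a n + y) \<le> 4 * M\<^sup>2 * (1 / a (Suc n))"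
    by (intro mult_left_mono) auto
  moreover have "4 * M\<^sup>2 * y = 1 / (d n)\<^sup>2" using Mp by (simp add: y_def)
  ultimately show ?case using Suc.IH[OF an] dp by (auto simp: less_Suc_eq distrib_left)
qed

text \<open>The arithmetic mean of the \<open>1 / (d k)\<^sup>2\<close> dominates their geometric mean.\<close>
lemma sum_inverse_squares_ge:
  fixes d :: "nat \<Rightarrow> real"
  assumes n: "n \<ge> 1" and d: "\<forall>k<n. d k > 0" and Y: "Y > 0" and le: "(\<Prod>k<n. d k) \<le> Y ^ n"
  shows "real n / Y\<^sup>2 \<le> (\<Sum>k<n. 1 / (d k)\<^sup>2)"
proof -
  have pos: "(\<Prod>k<n. d k) > 0" using d by (intro prod_pos) auto
  have Y2: "1 / Y\<^sup>2 > 0" using Y by simp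
  have "((1 / Y\<^sup>2) ^ n) powr (1 / n) = (1 / Y\<^sup>2) powr (n * (1 / n))"
    by (simp only: powr_realpow[OF Y2, symmetric] powr_powr)
  also have "\<dots> = 1 / Y\<^sup>2" using n Y2 by simp
  finally have "1 / Y\<^sup>2 = ((1 / Y\<^sup>2) ^ n) powr (1 / n)" ..
  also have "\<dots> \<le> (\<Prod>k<n. 1 / (d k)\<^sup>2) powr (1 / n)"
  proof (intro powr_mono2)
    have "(\<Prod>k<n. 1 / (d k)\<^sup>2) = 1 / (\<Prod>k<n. d k)\<^sup>2" by (simp add: prod_dividef prod_power_distrib)
    moreover have "(\<Prod>k<n. d k)\<^sup>2 \<le> (Y ^ n)\<^sup>2" using le pos by (intro power_mono) auto
    ultimately have "1 / (Y ^ n)\<^sup>2 \<le> (\<Prod>k<n. 1 / (d k)\<^sup>2)"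
      using pos Y by (metis divide_left_mono mult_pos_pos zero_le_one zero_less_power)
    then show "(1 / Y\<^sup>2) ^ n \<le> (\<Prod>k<n. 1 / (d k)\<^sup>2)"
      by (simp add: power_one_over power_mult[symmetric] mult.commute)
  qed (use Y in auto)
  also have "\<dots> \<le> (\<Sum>k<n. 1 / (d k)\<^sup>2 / n)"
    using arith_geom_mean[of "{..<n}" "\<lambda>k. 1 / (d k)\<^sup>2"] n by (auto simp: lessThan_empty_iff)
  also have "\<dots> = (\<Sum>k<n. 1 / (d k)\<^sup>2) / n" by (rule sum_divide_distrib[symmetric])
  finally show ?thesis using n by (simp add: pos_le_divide_eq mult.commute)
qed

section \<open>Error bounds from metric entropy\<close>
lemma greedy_error_le_of_cover:
  fixes D :: "'a::real_inner set" and x :: "nat \<Rightarrow> 'a"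
  assumes run: "orthogonal_greedy_run D f g F" and h: "h \<in> variation_space D"
    and n: "n \<ge> 1" and \<epsilon>: "\<epsilon> > 0" and cover: "dict_hull D \<subseteq> (\<Union>i<2 ^ n. cball (x i) \<epsilon>)"
  shows "(norm (F n - f))\<^sup>2 \<le> (norm (f - h))\<^sup>2 + 1024 * (real_of_ereal (variation_norm D h))\<^sup>2 * \<epsilon>\<^sup>2"
proof -
  \<comment> \<open>The algorithm numbers its selections from 1, the Gram--Schmidt process from 0.\<close>
  define e where "e k = g (Suc k)" for k
  define M where "M = real_of_ereal (variation_norm D h)"
  define r where "r k = f - F k" for k
  define s where "s k = \<bar>e k \<bullet> r k\<bar>" for k
  define d where "d k = norm (orthogonal_part e k)" for k
  define a where "a k = (norm (r k))\<^sup>2 - (norm (f - h))\<^sup>2" for k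
  have proj: "is_orthogonal_projection (span (e ` {..<k})) f (F k)" for k
  proof (cases k)
    case 0
    then show ?thesis using run
      by (simp add: orthogonal_greedy_run_def is_orthogonal_projection_def orthogonal_def)
  next
    case (Suc m)
    have "e ` {..<k} = g ` {1..k}"
      by (simp add: e_def image_image[of g Suc, symmetric] image_Suc_lessThan)
    then show ?thesis using run Suc by (auto simp: orthogonal_greedy_run_def)
  qed
  have "is_arg_max (\<lambda>u. \<bar>u \<bullet> r k\<bar>) (\<lambda>u. u \<in> D) (e k)" for k
    using run unfolding orthogonal_greedy_run_def r_def e_def
    by (metis diff_Suc_1 le_add1 plus_1_eq_Suc)
  then have eD: "e k \<in> D" and s_max: "\<And>u. u \<in> D \<Longrightarrow> \<bar>u \<bullet> r k\<bar> \<le> s k" for k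
    by (auto simp: is_arg_max_linorder s_def)
  have M: "M \<ge> 0" unfolding M_def by (rule real_variation_norm_nonneg)
  \<comment> \<open>The residual is orthogonal to the iterate, so its squared norm is its inner product with \<open>f\<close>, which
    splits into parts from \<open>f - h\<close> and from \<open>h\<close>.\<close>
  have a_le: "a k \<le> 2 * M * s k" for k
  proof -
    have "F k \<bullet> r k = 0"
      using proj[of k] by (auto simp: is_orthogonal_projection_def orthogonal_def r_def inner_commute)
    then have "(norm (r k))\<^sup>2 = (f - h) \<bullet> r k + h \<bullet> r k"
      by (simp add: power2_norm_eq_inner r_def inner_diff_left)
    also have "(f - h) \<bullet> r k \<le> norm (f - h) * norm (r k)" by (rule norm_cauchy_schwarz)
    also have "\<dots> \<le> ((norm (f - h))\<^sup>2 + (norm (r k))\<^sup>2) / 2"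
      using sum_squares_bound[of "norm (f - h)" "norm (r k)"] by simp
    also have "h \<bullet> r k \<le> M * s k"
      using abs_inner_le_variation_norm[of D "r k" "s k" h] s_max h by (simp add: M_def s_def)
    finally show ?thesis by (simp add: a_def field_simps)
  qed
  have dec: "a (Suc k) \<le> a k - (s k)\<^sup>2 / (d k)\<^sup>2" for k
    using residual_norm_decrease(1)[OF proj[of k] proj[of "Suc k"]]
    by (simp add: a_def s_def d_def r_def)
  have d0: "s k = 0" if "d k = 0" for k
    using residual_norm_decrease(2)[OF proj[of k] proj[of "Suc k"]] that
    by (simp add: s_def d_def r_def)
  have "a n \<le> 1024 * M\<^sup>2 * \<epsilon>\<^sup>2"
  proof (cases "a n > 0")
    case True
    have dpos: "\<forall>k<n. d k > 0" and sum_le: "(\<Sum>k<n. 1 / (d k)\<^sup>2) \<le> 4 * M\<^sup>2 / a n"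
      using greedy_recursion[of M a s d n, OF M a_le dec _ _ d0 True] by (auto simp: s_def d_def)
    have "(\<Prod>k<n. d k) \<le> (16 * \<epsilon> * sqrt (real n)) ^ n"
      unfolding d_def
      using simplex_combination_in_dict_hull[of n e D] eD cover
      by (intro prod_norm_orthogonal_part_le[OF n \<epsilon>, where x = x]) blast
    then have "real n / (16 * \<epsilon> * sqrt (real n))\<^sup>2 \<le> (\<Sum>k<n. 1 / (d k)\<^sup>2)"
      using n \<epsilon> dpos by (intro sum_inverse_squares_ge) auto
    also note sum_le
    finally have "1 / (256 * \<epsilon>\<^sup>2) \<le> 4 * M\<^sup>2 / a n"
      using n by (simp add: power_mult_distrib)
    then show ?thesis using True \<epsilon> by (simp add: field_simps)
  next
    case False
    then show ?thesis by (smt (verit) mult_nonneg_nonneg zero_le_power2)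
  qed
  then show ?thesis by (simp add: a_def r_def M_def norm_minus_commute)
qed

lemma metric_entropy_nonneg: "metric_entropy n A \<ge> 0"
  unfolding metric_entropy_def by (rule Inf_greatest) auto

lemma cover_of_metric_entropy_less:
  assumes "metric_entropy n A < ereal \<epsilon>"
  obtains x :: "nat \<Rightarrow> 'a::metric_space" where "A \<subseteq> (\<Union>i<2 ^ n. cball (x i) \<epsilon>)"
proof -
  obtain \<epsilon>' and x :: "nat \<Rightarrow> 'a" where "\<epsilon>' < \<epsilon>" "A \<subseteq> (\<Union>i<2 ^ n. cball (x i) \<epsilon>')"
    using assms unfolding metric_entropy_def Inf_less_iff by auto
  moreover from this have "(\<Union>i<2 ^ n. cball (x i) \<epsilon>') \<subseteq> (\<Union>i<2 ^ n. cball (x i) \<epsilon>)"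
    by (intro UN_mono subset_cball) auto
  ultimately show ?thesis using that by blast
qed

text \<open>A cover of radius exactly \<open>\<epsilon>\<close> need not exist, and \<open>\<epsilon>\<close> may be 0, so the bound is obtained for all
  larger radii and passed to the limit.\<close>
theorem greedy_error_le_of_metric_entropy:
  fixes D :: "'a::real_inner set"
  assumes run: "orthogonal_greedy_run D f g F" and h: "h \<in> variation_space D"
    and n: "n \<ge> 1" and entropy: "metric_entropy n (dict_hull D) \<le> ereal \<epsilon>"
  shows "(norm (F n - f))\<^sup>2 \<le> (norm (f - h))\<^sup>2 + 1024 * (real_of_ereal (variation_norm D h))\<^sup>2 * \<epsilon>\<^sup>2"
proof -
  let ?R = "\<lambda>\<epsilon>. (norm (f - h))\<^sup>2 + 1024 * (real_of_ereal (variation_norm D h))\<^sup>2 * \<epsilon>\<^sup>2"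
  have "0 \<le> ereal \<epsilon>" using metric_entropy_nonneg entropy by (rule order_trans)
  then have "\<epsilon> \<ge> 0" by simp
  have "(norm (F n - f))\<^sup>2 \<le> ?R \<eta>" if "\<eta> > \<epsilon>" for \<eta>
  proof -
    have "metric_entropy n (dict_hull D) < ereal \<eta>"
      using entropy that by (metis ereal_less_le less_ereal.simps(1) order.strict_trans1)
    then obtain x :: "nat \<Rightarrow> 'a" where "dict_hull D \<subseteq> (\<Union>i<2 ^ n. cball (x i) \<eta>)"
      by (rule cover_of_metric_entropy_less)
    then show ?thesis
      using greedy_error_le_of_cover[OF run h n, of \<eta>] that \<open>\<epsilon> \<ge> 0\<close> by simp
  qed
  then have "\<forall>\<^sub>F \<eta> in at_right \<epsilon>. (norm (F n - f))\<^sup>2 \<le> ?R \<eta>"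
    by (auto simp: eventually_at_filter)
  moreover have "(?R \<longlongrightarrow> ?R \<epsilon>) (at_right \<epsilon>)" by (intro tendsto_intros)
  ultimately show ?thesis by (intro tendsto_lowerbound[of ?R "?R \<epsilon>" "at_right \<epsilon>"]) auto
qed

theorem theorem1:
  fixes D :: "'a::{real_inner, complete_space} set" and \<delta> C :: real
  assumes "\<delta> > 0"
    and "\<forall>u\<in>D. norm u \<le> 1"
    and "\<forall>n\<ge>1. metric_entropy n (dict_hull D) \<le> ereal (C * real n powr (- 1/2 - \<delta>))"
  shows "\<forall>f g F. orthogonal_greedy_run D f g F \<longrightarrow>
      (\<forall>h\<in>variation_space D. \<forall>n\<ge>1.
         (norm (F n - f))\<^sup>2 \<le> (norm (f - h))\<^sup>2
           + greedy_const \<delta> C * (real_of_ereal (variation_norm D h))\<^sup>2 * real n powr (- 1 - 2 * \<delta>)) \<and>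
      (f \<in> variation_space D \<longrightarrow> (\<forall>n\<ge>1.
         norm (F n - f)
           \<le> greedy_const' \<delta> C * real_of_ereal (variation_norm D f) * real n powr (- 1/2 - \<delta>)))"
proof (intro allI impI)
  fix f g F
  assume run: "orthogonal_greedy_run D f g F"
  let ?\<epsilon> = "\<lambda>n. C * real n powr (- 1/2 - \<delta>)"
  have bound: "(norm (F n - f))\<^sup>2 \<le> (norm (f - h))\<^sup>2 + 1024 * (real_of_ereal (variation_norm D h))\<^sup>2 * (?\<epsilon> n)\<^sup>2"
    if "h \<in> variation_space D" "n \<ge> 1" for h n
    using assms(3) that by (intro greedy_error_le_of_metric_entropy[OF run]) auto
  \<comment> \<open>Needed for the square root: entropies are nonnegative, which forces the sign of \<open>C\<close>.\<close>
  have "0 \<le> ereal (?\<epsilon> 1)"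
    using assms(3) by (intro order_trans[OF metric_entropy_nonneg]) blast
  then have C: "C \<ge> 0" by simp
  have sq: "(?\<epsilon> n)\<^sup>2 = C\<^sup>2 * real n powr (- 1 - 2 * \<delta>)" for n
    by (simp add: power_mult_distrib power2_eq_square powr_add[symmetric])
  show "(\<forall>h\<in>variation_space D. \<forall>n\<ge>1.
         (norm (F n - f))\<^sup>2 \<le> (norm (f - h))\<^sup>2
           + greedy_const \<delta> C * (real_of_ereal (variation_norm D h))\<^sup>2 * real n powr (- 1 - 2 * \<delta>)) \<and>
      (f \<in> variation_space D \<longrightarrow> (\<forall>n\<ge>1.
         norm (F n - f)
           \<le> greedy_const' \<delta> C * real_of_ereal (variation_norm D f) * real n powr (- 1/2 - \<delta>)))"
  proof (intro conjI ballI allI impI)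
    fix h and n :: nat
    assume "h \<in> variation_space D" "n \<ge> 1"
    then show "(norm (F n - f))\<^sup>2 \<le> (norm (f - h))\<^sup>2
        + greedy_const \<delta> C * (real_of_ereal (variation_norm D h))\<^sup>2 * real n powr (- 1 - 2 * \<delta>)"
      using bound[of h n] unfolding sq by (simp add: greedy_const_def mult_ac)
  next
    fix n :: nat
    assume "f \<in> variation_space D" "n \<ge> 1"
    then have "(norm (F n - f))\<^sup>2 \<le> (32 * C * real_of_ereal (variation_norm D f) * real n powr (- 1/2 - \<delta>))\<^sup>2"
      using bound[of f n] by (simp add: power_mult_distrib mult_ac)
    moreover have "0 \<le> 32 * C * real_of_ereal (variation_norm D f) * real n powr (- 1/2 - \<delta>)"
      using C real_variation_norm_nonneg[of D f] by simp
    ultimately show "norm (F n - f)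
        \<le> greedy_const' \<delta> C * real_of_ereal (variation_norm D f) * real n powr (- 1/2 - \<delta>)"
      unfolding greedy_const'_def by (rule power2_le_imp_le)
  qed
qed

end
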